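(* Let $(S,+,\cdot,\mu)$ be a near left semibrace, where the identity of the group $(S,\cdot)$ is $e$ and $x^{-1}$ is the inverse of $x$ in $(S,\cdot)$ for all $x\in S$. Define a new binary operation $\circ$ on $S$ by $x\circ y=x\,\mu(e)^{-1}y$ for all $x,y\in S$. Then $(S,+,\circ)$ is a strong left semibrace, and so $(S,+)$ is a rectangular group and $\mu(e)\in E(S,+)$. Moreover, if we denote $\overline{x}=\mu(e)x^{-1}\mu(e)$ for all $x\in S$, then $$\overline{r}_S:S\times S\to S\times S,\quad (x,y)\mapsto\bigl(x\circ(\overline{x}+y),\ \overline{\overline{x}+y}\circ y\bigr)$$ is a set-theoretic solution of the Yang-Baxter equation.
   Context: Multiplication has higher precedence than addition. A near left semibrace is a quadruple $(S,+,\cdot,\mu)$ where $(S,+)$ is a (not necessarily commutative) semigroup, $(S,\cdot)$ is a group, and $\mu:S\to S$ is a map such that $x(y+z)=xy+\mu(x)+xz$ for all $x,y,z\in S$. A left semibrace is a triple $(S,+,\cdot)$ such that $(S,+)$ is a semigroup, $(S,\cdot)$ is a group, and $x(y+z)=xy+x(x^{-1}+z)$ for all $x,y,z\in S$, where $x^{-1}$ is the inverse of $x$ in $(S,\cdot)$. For $a\in S$ let $\overline{\rho}_a:S\to S$, $b\mapsto(b^{-1}+a)^{-1}a$. A left semibrace is called strong if $a\mapsto\overline{\rho}_a$ is a semigroup anti-homomorphism from $(S,\cdot)$ to the semigroup of maps $S\to S$ under composition, i.e. $\overline{\rho}_{ab}=\overline{\rho}_b\circ\overline{\rho}_a$ (composition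 of maps) for all $a,b\in S$. (For the triple $(S,+,\circ)$ these definitions are applied with $\circ$ as the multiplication and with inverses taken in $(S,\circ)$.) $E(S,+)=\{u\in S:u+u=u\}$. A rectangular group is a semigroup isomorphic to a set $I\times G\times\Lambda$, where $(G,+)$ is a (not necessarily abelian) group and $I,\Lambda$ are nonempty sets, with addition $(i,g,\lambda)+(j,h,\nu)=(i,g+h,\nu)$. A map $r:S\times S\to S\times S$ is a set-theoretic solution of the Yang-Baxter equation if $(r\times\mathrm{id}_S)(\mathrm{id}_S\times r)(r\times\mathrm{id}_S)=(\mathrm{id}_S\times r)(r\times\mathrm{id}_S)(\mathrm{id}_S\times r)$ as maps $S\times S\times S\to S\times S\times S$ (no bijectivity is required). *)

theory Defs
  imports "HOL-Algebra.Group"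
begin

text \<open>
  A structure \<open>(S, +, \<cdot>)\<close> is rendered as a group record \<open>B\<close> with carrier \<open>S\<close> and multiplication
  \<open>\<cdot>\<close>, together with a separate (not necessarily commutative) addition on that carrier.
\<close>

locale add_semigroup =
  fixes S :: "'a set" and add :: "'a \<Rightarrow> 'a \<Rightarrow> 'a" (infixl \<open>\<boxplus>\<close> 65)
  assumes add_closed: "\<lbrakk>x \<in> S; y \<in> S\<rbrakk> \<Longrightarrow> x \<boxplus> y \<in> S"
    and add_assoc: "\<lbrakk>x \<in> S; y \<in> S; z \<in> S\<rbrakk> \<Longrightarrow> (x \<boxplus> y) \<boxplus> z = x \<boxplus> (y \<boxplus> z)"

locale near_left_semibrace =
  group B + add_semigroup "carrier B" add
  for B :: "('a, 'b) monoid_scheme" (structure) and add :: "'a \<Rightarrow> 'a \<Rightarrow> 'a" (infixl \<open>\<boxplus>\<close> 65) +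
  fixes mu :: "'a \<Rightarrow> 'a"
  assumes mu_closed: "mu \<in> carrier B \<rightarrow> carrier B"
    and near_distrib: "\<lbrakk>x \<in> carrier B; y \<in> carrier B; z \<in> carrier B\<rbrakk>
      \<Longrightarrow> x \<otimes> (y \<boxplus> z) = x \<otimes> y \<boxplus> mu x \<boxplus> x \<otimes> z"

locale left_semibrace =
  group B + add_semigroup "carrier B" add
  for B :: "('a, 'b) monoid_scheme" (structure) and add :: "'a \<Rightarrow> 'a \<Rightarrow> 'a" (infixl \<open>\<boxplus>\<close> 65) +
  assumes semibrace_distrib: "\<lbrakk>x \<in> carrier B; y \<in> carrier B; z \<in> carrier B\<rbrakk>
      \<Longrightarrow> x \<otimes> (y \<boxplus> z) = x \<otimes> y \<boxplus> x \<otimes> (inv x \<boxplus> z)"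

text \<open>
  Self-maps of the carrier are extensional functions, so that equality of maps is equality in HOL;
  accordingly \<open>compose\<close> is the composition of maps of the carrier.
\<close>

definition rho_bar :: "('a, 'b) monoid_scheme \<Rightarrow> ('a \<Rightarrow> 'a \<Rightarrow> 'a) \<Rightarrow> 'a \<Rightarrow> 'a \<Rightarrow> 'a" where
  "rho_bar B add a = (\<lambda>b \<in> carrier B. inv\<^bsub>B\<^esub> (add (inv\<^bsub>B\<^esub> b) a) \<otimes>\<^bsub>B\<^esub> a)"

locale strong_left_semibrace = left_semibrace +
  assumes rho_bar_anti_hom: "\<lbrakk>a \<in> carrier B; b \<in> carrier B\<rbrakk>
      \<Longrightarrow> rho_bar B add (a \<otimes> b) = compose (carrier B) (rho_bar B add b) (rho_bar B add a)"

definition add_idempotents :: "'a set \<Rightarrow> ('a \<Rightarrow> 'a \<Rightarrow> 'a) \<Rightarrow> 'a set" where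
  "add_idempotents S add = {u \<in> S. add u u = u}"

fun rect_add :: "('g, 'm) monoid_scheme \<Rightarrow> 'i \<times> 'g \<times> 'l \<Rightarrow> 'i \<times> 'g \<times> 'l \<Rightarrow> 'i \<times> 'g \<times> 'l" where
  "rect_add G (i, g, l) (j, h, n) = (i, g \<otimes>\<^bsub>G\<^esub> h, n)"

text \<open>
  Types cannot be quantified existentially, so the sets \<open>I\<close>, \<open>G\<close>, \<open>\<Lambda>\<close> are taken inside the type of
  \<open>S\<close>. This loses no generality, since each of them embeds into \<open>I \<times> G \<times> \<Lambda>\<close>: see
  \<open>rectangular_groupI\<close> below.
\<close>

definition rectangular_group :: "'a set \<Rightarrow> ('a \<Rightarrow> 'a \<Rightarrow> 'a) \<Rightarrow> bool" where
  "rectangular_group S add \<longleftrightarrow> add_semigroup S add \<and>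
    (\<exists>(I :: 'a set) (G :: 'a monoid) (L :: 'a set) f.
      I \<noteq> {} \<and> group G \<and> L \<noteq> {} \<and> bij_betw f S (I \<times> carrier G \<times> L) \<and>
      (\<forall>x\<in>S. \<forall>y\<in>S. f (add x y) = rect_add G (f x) (f y)))"

lemma rectangular_groupI:
  fixes S :: "'a set" and I :: "'i set" and G :: "('g, 'm) monoid_scheme" and L :: "'l set"
  assumes sg: "add_semigroup S add" and I: "I \<noteq> {}" and G: "group G" and L: "L \<noteq> {}"
    and bij: "bij_betw f S (I \<times> carrier G \<times> L)"
    and hom: "\<And>x y. \<lbrakk>x \<in> S; y \<in> S\<rbrakk> \<Longrightarrow> f (add x y) = rect_add G (f x) (f y)"
  shows "rectangular_group S add"
proof -
  interpret G: group G by (fact G)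
  obtain i0 l0 where i0: "i0 \<in> I" and l0: "l0 \<in> L" using I L by blast
  define h where "h = inv_into S f"
  have h: "bij_betw h (I \<times> carrier G \<times> L) S"
    unfolding h_def using bij by (rule bij_betw_inv_into)
  then have h_inj: "inj_on h (I \<times> carrier G \<times> L)" by (rule bij_betw_imp_inj_on)
  define a where "a = (\<lambda>i. h (i, \<one>\<^bsub>G\<^esub>, l0))"
  define b where "b = (\<lambda>g. h (i0, g, l0))"
  define c where "c = (\<lambda>l. h (i0, \<one>\<^bsub>G\<^esub>, l))"
  have a: "inj_on a I" and b: "inj_on b (carrier G)" and c: "inj_on c L"
    using i0 l0 by (simp_all add: inj_on_def a_def b_def c_def inj_on_eq_iff[OF h_inj])
  define d where "d = the_inv_into (carrier G) b"
  have d: "d (b g) = g" if "g \<in> carrier G" for g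
    unfolding d_def using b that by (rule the_inv_into_f_f)
  define K where "K = \<lparr>carrier = b ` carrier G, mult = (\<lambda>x y. b (d x \<otimes>\<^bsub>G\<^esub> d y)), one = b \<one>\<^bsub>G\<^esub>\<rparr>"
  have K: "group K"
  proof (rule groupI)
    fix x assume "x \<in> carrier K"
    then obtain g where g: "g \<in> carrier G" "x = b g" by (auto simp: K_def)
    show "\<exists>y\<in>carrier K. y \<otimes>\<^bsub>K\<^esub> x = \<one>\<^bsub>K\<^esub>"
      by (rule bexI[of _ "b (inv\<^bsub>G\<^esub> g)"]) (use g in \<open>auto simp: K_def d\<close>)
  qed (auto simp: K_def d G.m_assoc)
  define p where "p = (\<lambda>(i, g, l). (a i, b g, c l))"
  have p: "bij_betw p (I \<times> carrier G \<times> L) (a ` I \<times> carrier K \<times> c ` L)"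
    unfolding bij_betw_def
  proof
    show "inj_on p (I \<times> carrier G \<times> L)"
      using a b c by (auto simp: p_def inj_on_def)
    show "p ` (I \<times> carrier G \<times> L) = a ` I \<times> carrier K \<times> c ` L"
      by (force simp: p_def K_def)
  qed
  have mem: "f x \<in> I \<times> carrier G \<times> L" if "x \<in> S" for x
    using bij that by (auto simp: bij_betw_def)
  have p_hom: "p (rect_add G u v) = rect_add K (p u) (p v)"
    if "u \<in> I \<times> carrier G \<times> L" "v \<in> I \<times> carrier G \<times> L" for u v
    using that by (auto simp: p_def K_def d)
  have "bij_betw (p \<circ> f) S (a ` I \<times> carrier K \<times> c ` L)"
    using bij p by (rule bij_betw_trans)
  moreover have "\<forall>x\<in>S. \<forall>y\<in>S. (p \<circ> f) (add x y) = rect_add K ((p \<circ> f) x) ((p \<circ> f) y)"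
    using hom mem p_hom by simp
  moreover have "a ` I \<noteq> {}" "c ` L \<noteq> {}" using I L by simp_all
  ultimately show ?thesis
    unfolding rectangular_group_def using sg K by (intro conjI exI) assumption+
qed

definition yb12 :: "('a \<times> 'a \<Rightarrow> 'a \<times> 'a) \<Rightarrow> 'a \<times> 'a \<times> 'a \<Rightarrow> 'a \<times> 'a \<times> 'a" where
  "yb12 r = (\<lambda>(x, y, z). let (u, v) = r (x, y) in (u, v, z))"

definition yb23 :: "('a \<times> 'a \<Rightarrow> 'a \<times> 'a) \<Rightarrow> 'a \<times> 'a \<times> 'a \<Rightarrow> 'a \<times> 'a \<times> 'a" where
  "yb23 r = (\<lambda>(x, y, z). (x, r (y, z)))"

definition yang_baxter_solution :: "'a set \<Rightarrow> ('a \<times> 'a \<Rightarrow> 'a \<times> 'a) \<Rightarrow> bool" where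
  "yang_baxter_solution S r \<longleftrightarrow> r \<in> S \<times> S \<rightarrow> S \<times> S \<and>
    (\<forall>t \<in> S \<times> S \<times> S.
      (yb12 r \<circ> yb23 r \<circ> yb12 r) t = (yb23 r \<circ> yb12 r \<circ> yb23 r) t)"

text \<open>
  The group record for \<open>(S, \<circ>)\<close> has to name its identity; as \<open>x \<circ> \<mu>(e) = x\<close>, the only possible
  choice is \<open>\<mu>(e)\<close>.
\<close>

definition circ_group :: "('a, 'b) monoid_scheme \<Rightarrow> ('a \<Rightarrow> 'a) \<Rightarrow> 'a monoid" where
  "circ_group B mu = \<lparr>carrier = carrier B,
     mult = (\<lambda>x y. x \<otimes>\<^bsub>B\<^esub> inv\<^bsub>B\<^esub> (mu \<one>\<^bsub>B\<^esub>) \<otimes>\<^bsub>B\<^esub> y),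
     one = mu \<one>\<^bsub>B\<^esub>\<rparr>"

definition circ_bar :: "('a, 'b) monoid_scheme \<Rightarrow> ('a \<Rightarrow> 'a) \<Rightarrow> 'a \<Rightarrow> 'a" where
  "circ_bar B mu x = mu \<one>\<^bsub>B\<^esub> \<otimes>\<^bsub>B\<^esub> inv\<^bsub>B\<^esub> x \<otimes>\<^bsub>B\<^esub> mu \<one>\<^bsub>B\<^esub>"

definition r_bar :: "('a, 'b) monoid_scheme \<Rightarrow> ('a \<Rightarrow> 'a \<Rightarrow> 'a) \<Rightarrow> ('a \<Rightarrow> 'a) \<Rightarrow> 'a \<times> 'a \<Rightarrow> 'a \<times> 'a" where
  "r_bar B add mu = (\<lambda>(x, y).
     (x \<otimes>\<^bsub>circ_group B mu\<^esub> add (circ_bar B mu x) y,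
      circ_bar B mu (add (circ_bar B mu x) y) \<otimes>\<^bsub>circ_group B mu\<^esub> y))"

end

theory Submission
  imports Defs
begin

text \<open>
  Write \<open>m = \<mu>(e)\<close>. Left translation by \<open>m\<inverse>\<close> is an isomorphism from \<open>(S, \<circ>)\<close> onto \<open>(S, \<cdot>)\<close>, so
  \<open>(S, \<circ>)\<close> is a group with identity \<open>m\<close> and inversion \<open>x \<mapsto> m x\<inverse> m\<close>. Passing from \<open>\<cdot>\<close> to \<open>\<circ>\<close>
  moves \<open>m\<close> to the identity: with \<open>\<nu>(x) = \<mu>(x m\<inverse>)\<close> one has \<open>x \<circ> (y + z) = x \<circ> y + \<nu>(x) + x \<circ> z\<close>,
  and distributing \<open>e\<close> over \<open>y + z\<close> gives \<open>y + z = y + m + z\<close>. Thus a summand \<open>m\<close> may be inserted or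
  dropped between any two others, and both the semibrace law and the strongness law reduce to this
  (\<open>near_left_semibrace.strong_left_semibrace_circ\<close>).

  The remaining assertions hold in every strong left semibrace \<open>(S, +, \<cdot>)\<close> with identity \<open>e\<close>.
  Such a structure again satisfies
  \<open>x (y + z) = x y + \<nu>(x) + x z\<close>, now with \<open>\<nu>(x) = x (x\<inverse> + x\<inverse>)\<close>
  (\<open>strong_left_semibrace.distrib_defect\<close>). Comparing \<open>a + b\<close> with \<open>x (x\<inverse> (a + b))\<close> shows that
  between any two summands \<open>x + \<nu>(x)\<close> and \<open>\<nu>(x) + x\<close> can be deleted, so \<open>\<nu>(x)\<close> is an inverse of
  \<open>x\<close> there. As multiplication is a group, every element is a sum of two others, hence these
  deletions describe the whole semigroup: \<open>w\<close> is determined by the idempotent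
  \<open>w + \<nu>(w) + e\<close>, the element \<open>e + w + e\<close> of the group \<open>e + S + e\<close>, and the idempotent
  \<open>e + \<nu>(w) + w\<close>, and this is the rectangular decomposition
  (\<open>add_semigroup.rectangular_group_of_inner_inverses\<close>). In particular \<open>e\<close> itself is regular, and
  \<open>e = e + \<nu>(e) + e = e + e + \<nu>(e) + e = e + e\<close>.

  For the Yang-Baxter equation put \<open>\<lambda>\<^sub>x(y) = x (x\<inverse> + y)\<close> and \<open>\<rho>\<^sub>y(x) = (x\<inverse> + y)\<inverse> y\<close>. Then
  \<open>\<lambda>\<^sub>x(y) \<rho>\<^sub>y(x) = x y\<close>, \<open>\<lambda>\<close> is multiplicative and \<open>\<rho>\<close> is antimultiplicative. The outer components
  of the two sides agree because \<open>\<lambda>\<close> and \<open>\<rho>\<close> depend on the product only, and the middle ones agree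
  because both sides have the same total product
  (\<open>group.yang_baxter_of_matched_actions\<close>).
\<close>

section \<open>Semigroups with inverses between summands\<close>

context add_semigroup
begin

text \<open>
  The hypotheses say that, between two summands, \<open>e\<close> behaves as zero and \<open>n x\<close> as the negative of
  \<open>x\<close>. Writing \<open>w = a + b\<close> turns \<open>w + n w + w\<close> into a sum in which all cancellation takes place
  strictly between \<open>a\<close> and \<open>b\<close>; regularity of \<open>e\<close> then gives its idempotence.
\<close>

lemma
  assumes e: "e \<in> S" and n: "\<And>x. x \<in> S \<Longrightarrow> n x \<in> S"
    and neutral: "\<And>a b. \<lbrakk>a \<in> S; b \<in> S\<rbrakk> \<Longrightarrow> a \<boxplus> (e \<boxplus> b) = a \<boxplus> b"
    and right: "\<And>a b x. \<lbrakk>a \<in> S; b \<in> S; x \<in> S\<rbrakk> \<Longrightarrow> a \<boxplus> (x \<boxplus> (n x \<boxplus> b)) = a \<boxplus> b"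
    and left: "\<And>a b x. \<lbrakk>a \<in> S; b \<in> S; x \<in> S\<rbrakk> \<Longrightarrow> a \<boxplus> (n x \<boxplus> (x \<boxplus> b)) = a \<boxplus> b"
    and sums: "\<And>w. w \<in> S \<Longrightarrow> \<exists>a\<in>S. \<exists>b\<in>S. w = a \<boxplus> b"
  shows regular_of_inner_inverses: "w \<in> S \<Longrightarrow> w \<boxplus> (n w \<boxplus> w) = w"
    and neutral_idempotent_of_inner_inverses: "e \<boxplus> e = e"
proof -
  show regular: "w \<boxplus> (n w \<boxplus> w) = w" if w: "w \<in> S" for w
  proof -
    obtain a b where ab: "a \<in> S" "b \<in> S" "w = a \<boxplus> b" using sums w by blast
    note [simp] = ab(1,2) n w add_closed
    have "w \<boxplus> (n w \<boxplus> w) = a \<boxplus> (b \<boxplus> (n w \<boxplus> (a \<boxplus> b)))"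
      using ab by (simp add: add_assoc[symmetric])
    also have "\<dots> = a \<boxplus> (n a \<boxplus> (a \<boxplus> (b \<boxplus> (n w \<boxplus> (a \<boxplus> b)))))"
      by (simp add: left)
    also have "\<dots> = (a \<boxplus> n a) \<boxplus> (w \<boxplus> (n w \<boxplus> (a \<boxplus> b)))"
      using ab by (simp add: add_assoc)
    also have "\<dots> = (a \<boxplus> n a) \<boxplus> (a \<boxplus> b)"
      by (rule right) simp_all
    also have "\<dots> = w"
      using ab by (simp add: add_assoc left)
    finally show ?thesis .
  qed
  have "e \<boxplus> e = e \<boxplus> (e \<boxplus> (n e \<boxplus> e))" by (simp add: right e)
  also have "\<dots> = e \<boxplus> (n e \<boxplus> e)" by (simp add: neutral e n add_closed)
  also have "\<dots> = e" by (rule regular[OF e])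
  finally show "e \<boxplus> e = e" .
qed

text \<open>
  The decomposition sends \<open>w\<close> to \<open>(w + n w + e, e + w + e, e + n w + w)\<close>, with inverse
  \<open>(i, g, l) \<mapsto> i + g + l\<close>. The first component survives the addition of a summand on the right
  because that summand and its negative cancel; the third one is dual.
\<close>

lemma rectangular_group_of_inner_inverses:
  assumes e: "e \<in> S" and n: "\<And>x. x \<in> S \<Longrightarrow> n x \<in> S"
    and neutral: "\<And>a b. \<lbrakk>a \<in> S; b \<in> S\<rbrakk> \<Longrightarrow> a \<boxplus> (e \<boxplus> b) = a \<boxplus> b"
    and right: "\<And>a b x. \<lbrakk>a \<in> S; b \<in> S; x \<in> S\<rbrakk> \<Longrightarrow> a \<boxplus> (x \<boxplus> (n x \<boxplus> b)) = a \<boxplus> b"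
    and left: "\<And>a b x. \<lbrakk>a \<in> S; b \<in> S; x \<in> S\<rbrakk> \<Longrightarrow> a \<boxplus> (n x \<boxplus> (x \<boxplus> b)) = a \<boxplus> b"
    and sums: "\<And>w. w \<in> S \<Longrightarrow> \<exists>a\<in>S. \<exists>b\<in>S. w = a \<boxplus> b"
  shows "rectangular_group S add"
proof -
  note regular = regular_of_inner_inverses[OF e n neutral right left sums]
  have ee: "e \<boxplus> e = e"
    by (rule neutral_idempotent_of_inner_inverses[OF e n neutral right left sums])
  note [simp] = e n add_closed
  define I where "I = {i \<in> S. i \<boxplus> e = i \<and> e \<boxplus> i = e}"
  define L where "L = {l \<in> S. e \<boxplus> l = l \<and> l \<boxplus> e = e}"
  define G where "G = \<lparr>carrier = {g \<in> S. e \<boxplus> g = g \<and> g \<boxplus> e = g}, mult = add, one = e\<rparr>"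
  define f where "f = (\<lambda>w. (w \<boxplus> (n w \<boxplus> e), e \<boxplus> (w \<boxplus> e), e \<boxplus> (n w \<boxplus> w)))"
  have G: "group G"
  proof (rule groupI)
    fix x y assume "x \<in> carrier G" "y \<in> carrier G"
    then have x: "x \<in> S" "e \<boxplus> x = x" "x \<boxplus> e = x" and y: "y \<in> S" "e \<boxplus> y = y" "y \<boxplus> e = y"
      by (auto simp: G_def)
    have "e \<boxplus> (x \<boxplus> y) = x \<boxplus> y" using x y add_assoc[of e x y] by simp
    moreover have "x \<boxplus> y \<boxplus> e = x \<boxplus> y" using x y by (simp add: add_assoc)
    ultimately show "x \<otimes>\<^bsub>G\<^esub> y \<in> carrier G" using x y by (simp add: G_def)
  next
    fix x assume "x \<in> carrier G"
    then have x: "x \<in> S" "e \<boxplus> x = x" "x \<boxplus> e = x" by (auto simp: G_def)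
    have "e \<boxplus> (n x \<boxplus> e) \<boxplus> x = e"
      using x left[of e e x] by (simp add: add_assoc neutral ee)
    moreover have "e \<boxplus> (n x \<boxplus> e) \<in> carrier G"
      by (simp add: G_def add_assoc neutral ee x)
    ultimately show "\<exists>y\<in>carrier G. y \<otimes>\<^bsub>G\<^esub> x = \<one>\<^bsub>G\<^esub>"
      by (auto simp: G_def)
  qed (auto simp: G_def ee add_assoc)
  have f_mem: "f w \<in> I \<times> carrier G \<times> L" if "w \<in> S" for w
    using that by (simp add: f_def I_def G_def L_def add_assoc neutral right left ee)
  have f_hom: "f (x \<boxplus> y) = rect_add G (f x) (f y)" if x: "x \<in> S" and y: "y \<in> S" for x y
  proof -
    note [simp] = x y
    have "x \<boxplus> (n x \<boxplus> e) = x \<boxplus> n x \<boxplus> ((x \<boxplus> y) \<boxplus> (n (x \<boxplus> y) \<boxplus> e))"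
      using right[of "x \<boxplus> n x" e "x \<boxplus> y"] by (simp add: add_assoc)
    also have "\<dots> = (x \<boxplus> (n x \<boxplus> x)) \<boxplus> (y \<boxplus> (n (x \<boxplus> y) \<boxplus> e))"
      by (simp add: add_assoc)
    also have "\<dots> = x \<boxplus> y \<boxplus> (n (x \<boxplus> y) \<boxplus> e)"
      by (simp add: regular add_assoc)
    finally have 1: "x \<boxplus> y \<boxplus> (n (x \<boxplus> y) \<boxplus> e) = x \<boxplus> (n x \<boxplus> e)" by simp
    have "e \<boxplus> (n y \<boxplus> y) = e \<boxplus> (n (x \<boxplus> y) \<boxplus> ((x \<boxplus> y) \<boxplus> (n y \<boxplus> y)))"
      using left[of e "n y \<boxplus> y" "x \<boxplus> y"] by simp
    also have "\<dots> = e \<boxplus> (n (x \<boxplus> y) \<boxplus> (x \<boxplus> (y \<boxplus> (n y \<boxplus> y))))"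
      by (simp add: add_assoc)
    also have "\<dots> = e \<boxplus> (n (x \<boxplus> y) \<boxplus> (x \<boxplus> y))"
      by (simp add: regular)
    finally have 2: "e \<boxplus> (n (x \<boxplus> y) \<boxplus> (x \<boxplus> y)) = e \<boxplus> (n y \<boxplus> y)" by simp
    show ?thesis
      using 1 2 by (simp add: f_def G_def add_assoc neutral)
  qed
  have f_bij: "bij_betw f S (I \<times> carrier G \<times> L)"
  proof (rule bij_betw_byWitness[where f' = "\<lambda>(i, g, l). i \<boxplus> (g \<boxplus> l)"])
    show "\<forall>w\<in>S. (\<lambda>(i, g, l). i \<boxplus> (g \<boxplus> l)) (f w) = w"
      by (simp add: f_def add_assoc neutral left regular)
    show "f ` S \<subseteq> I \<times> carrier G \<times> L" using f_mem by blast
    show "(\<lambda>(i, g, l). i \<boxplus> (g \<boxplus> l)) ` (I \<times> carrier G \<times> L) \<subseteq> S"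
      by (auto simp: I_def G_def L_def)
    show "\<forall>t\<in>I \<times> carrier G \<times> L. f ((\<lambda>(i, g, l). i \<boxplus> (g \<boxplus> l)) t) = t"
    proof (clarify)
      fix i g l assume "i \<in> I" "g \<in> carrier G" "l \<in> L"
      then have i: "i \<in> S" "i \<boxplus> e = i" "e \<boxplus> i = e" and g: "g \<in> S" "e \<boxplus> g = g" "g \<boxplus> e = g"
        and l: "l \<in> S" "e \<boxplus> l = l" "l \<boxplus> e = e"
        by (auto simp: I_def G_def L_def)
      note [simp] = i(1) g(1) l(1)
      define w where "w = i \<boxplus> (g \<boxplus> l)"
      have w[simp]: "w \<in> S" by (simp add: w_def)
      have "i \<boxplus> i = i" using i neutral[of i i] by simp
      then have iw: "i \<boxplus> w = w" using add_assoc[of i i "g \<boxplus> l"] by (simp add: w_def)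
      have "l \<boxplus> l = l" using l neutral[of l l] add_assoc[of l e l] by simp
      then have wl: "w \<boxplus> l = w" by (simp add: w_def add_assoc)
      have "i = i \<boxplus> (w \<boxplus> (n w \<boxplus> e))" using i right[of i e w] by simp
      then have 1: "w \<boxplus> (n w \<boxplus> e) = i" using iw add_assoc[of i w "n w \<boxplus> e"] by simp
      have "l = e \<boxplus> (n w \<boxplus> (w \<boxplus> l))" using l left[of e l w] by simp
      then have 2: "e \<boxplus> (n w \<boxplus> w) = l" using wl by simp
      have "e \<boxplus> (w \<boxplus> e) = (e \<boxplus> i) \<boxplus> (g \<boxplus> (l \<boxplus> e))"
        by (simp add: w_def add_assoc)
      then have 3: "e \<boxplus> (w \<boxplus> e) = g" using i g l by simp
      show "f (i \<boxplus> (g \<boxplus> l)) = (i, g, l)"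
        using 1 2 3 by (simp add: f_def flip: w_def)
    qed
  qed
  have "e \<in> I" "e \<in> L" by (simp_all add: I_def L_def ee)
  then show ?thesis
    using rectangular_groupI[where f = f and I = I and G = G and L = L] add_semigroup_axioms
      G f_bij f_hom by blast
qed

end

section \<open>Yang-Baxter solutions from matched actions\<close>

text \<open>
  Either side of the equation is obtained from a triple by replacing adjacent pairs by pairs with
  the same product, so the total product is preserved. Once the outer components are known to
  agree, cancellation yields the middle one.
\<close>

lemma (in group) yang_baxter_of_matched_actions:
  assumes r: "\<And>x y. \<lbrakk>x \<in> carrier G; y \<in> carrier G\<rbrakk> \<Longrightarrow> r (x, y) = (lam x y, rho y x)"
    and lam_closed: "\<And>x y. \<lbrakk>x \<in> carrier G; y \<in> carrier G\<rbrakk> \<Longrightarrow> lam x y \<in> carrier G"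
    and rho_closed: "\<And>x y. \<lbrakk>x \<in> carrier G; y \<in> carrier G\<rbrakk> \<Longrightarrow> rho y x \<in> carrier G"
    and matched: "\<And>x y. \<lbrakk>x \<in> carrier G; y \<in> carrier G\<rbrakk> \<Longrightarrow> lam x y \<otimes> rho y x = x \<otimes> y"
    and lam_hom: "\<And>x y z. \<lbrakk>x \<in> carrier G; y \<in> carrier G; z \<in> carrier G\<rbrakk>
      \<Longrightarrow> lam (x \<otimes> y) z = lam x (lam y z)"
    and rho_anti_hom: "\<And>x y z. \<lbrakk>x \<in> carrier G; y \<in> carrier G; z \<in> carrier G\<rbrakk>
      \<Longrightarrow> rho (y \<otimes> z) x = rho z (rho y x)"
  shows "yang_baxter_solution (carrier G) r"
  unfolding yang_baxter_solution_def
proof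
  show "r \<in> carrier G \<times> carrier G \<rightarrow> carrier G \<times> carrier G"
    using r lam_closed rho_closed by auto
  show "\<forall>t\<in>carrier G \<times> carrier G \<times> carrier G.
    (yb12 r \<circ> yb23 r \<circ> yb12 r) t = (yb23 r \<circ> yb12 r \<circ> yb23 r) t"
  proof clarify
    fix x y z assume [simp]: "x \<in> carrier G" "y \<in> carrier G" "z \<in> carrier G"
    note [simp] = lam_closed rho_closed
    define a b c where "a = lam (lam x y) (lam (rho y x) z)"
      and "b = rho (lam (rho y x) z) (lam x y)" and "c = rho z (rho y x)"
    define a' b' c' where "a' = lam x (lam y z)"
      and "b' = lam (rho (lam y z) x) (rho z y)" and "c' = rho (rho z y) (rho (lam y z) x)"
    have lhs: "(yb12 r \<circ> yb23 r \<circ> yb12 r) (x, y, z) = (a, b, c)"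
      by (simp add: yb12_def yb23_def r a_def b_def c_def)
    have rhs: "(yb23 r \<circ> yb12 r \<circ> yb23 r) (x, y, z) = (a', b', c')"
      by (simp add: yb12_def yb23_def r a'_def b'_def c'_def)
    have mem[simp]: "a \<in> carrier G" "b \<in> carrier G" "c \<in> carrier G" "b' \<in> carrier G"
      by (simp_all add: a_def b_def c_def b'_def)
    have a: "a' = a"
      by (simp add: a_def a'_def matched flip: lam_hom)
    have c: "c' = c"
      by (simp add: c_def c'_def matched flip: rho_anti_hom)
    have "a \<otimes> b \<otimes> c = lam x y \<otimes> lam (rho y x) z \<otimes> c"
      by (simp add: a_def b_def matched)
    also have "\<dots> = lam x y \<otimes> (lam (rho y x) z \<otimes> c)"
      by (simp add: m_assoc)
    also have "\<dots> = lam x y \<otimes> (rho y x \<otimes> z)"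
      by (simp add: c_def matched)
    also have "\<dots> = x \<otimes> y \<otimes> z"
      by (simp add: matched flip: m_assoc)
    also have "\<dots> = x \<otimes> (lam y z \<otimes> rho z y)"
      by (simp add: matched m_assoc)
    also have "\<dots> = x \<otimes> lam y z \<otimes> rho z y"
      by (simp add: m_assoc)
    also have "\<dots> = a' \<otimes> rho (lam y z) x \<otimes> rho z y"
      by (simp add: a'_def matched)
    also have "\<dots> = a' \<otimes> (rho (lam y z) x \<otimes> rho z y)"
      by (simp add: a'_def m_assoc)
    also have "\<dots> = a' \<otimes> (b' \<otimes> c')"
      by (simp add: b'_def c'_def matched)
    finally have "a \<otimes> (b \<otimes> c) = a \<otimes> (b' \<otimes> c)"
      by (simp add: a c m_assoc)
    then have "b = b'" by simp
    then show "(yb12 r \<circ> yb23 r \<circ> yb12 r) (x, y, z) = (yb23 r \<circ> yb12 r \<circ> yb23 r) (x, y, z)"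
      using lhs rhs a c by simp
  qed
qed

section \<open>Strong left semibraces\<close>

lemma (in left_semibrace) one_absorbed:
  assumes "y \<in> carrier B" "z \<in> carrier B"
  shows "y \<boxplus> (\<one> \<boxplus> z) = y \<boxplus> z"
  using semibrace_distrib[of \<one> y z] assms by (simp add: add_closed)

context strong_left_semibrace
begin

lemma strong_distrib:
  assumes [simp]: "x \<in> carrier B" "y \<in> carrier B" "z \<in> carrier B"
  shows "x \<otimes> (y \<boxplus> z) = x \<otimes> (y \<boxplus> inv x) \<boxplus> x \<otimes> z"
proof -
  note [simp] = add_closed
  \<comment> \<open>Antimultiplicativity of \<open>rho_bar\<close> for the pair \<open>x\<inverse>\<close>, \<open>x z\<close>, evaluated at \<open>y\<inverse>\<close>.\<close>
  have "rho_bar B add (inv x \<otimes> (x \<otimes> z)) (inv y)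
    = rho_bar B add (x \<otimes> z) (rho_bar B add (inv x) (inv y))"
    by (simp add: rho_bar_anti_hom compose_def)
  moreover have "inv (inv (y \<boxplus> inv x) \<otimes> inv x) = x \<otimes> (y \<boxplus> inv x)"
    by (simp add: inv_mult_group)
  ultimately have "inv (y \<boxplus> z) \<otimes> z = inv (x \<otimes> (y \<boxplus> inv x) \<boxplus> x \<otimes> z) \<otimes> x \<otimes> z"
    by (simp add: rho_bar_def flip: m_assoc)
  then have "inv (y \<boxplus> z) = inv (x \<otimes> (y \<boxplus> inv x) \<boxplus> x \<otimes> z) \<otimes> x"
    by simp
  then have "inv (inv (y \<boxplus> z)) = inv (inv (x \<otimes> (y \<boxplus> inv x) \<boxplus> x \<otimes> z) \<otimes> x)"
    by (rule arg_cong)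
  then have "y \<boxplus> z = inv x \<otimes> (x \<otimes> (y \<boxplus> inv x) \<boxplus> x \<otimes> z)"
    by (simp add: inv_mult_group)
  then show ?thesis
    by (simp flip: m_assoc)
qed

definition defect :: "'a \<Rightarrow> 'a" where
  "defect x = x \<otimes> (inv x \<boxplus> inv x)"

lemma defect_closed [simp]: "x \<in> carrier B \<Longrightarrow> defect x \<in> carrier B"
  by (simp add: defect_def add_closed)

text \<open>
  The semibrace law splits off the left summand and the strongness law the right one; what is left
  over does not depend on either of them.
\<close>

lemma distrib_defect:
  assumes [simp]: "x \<in> carrier B" "y \<in> carrier B" "z \<in> carrier B"
  shows "x \<otimes> (y \<boxplus> z) = x \<otimes> y \<boxplus> (defect x \<boxplus> x \<otimes> z)"
  using semibrace_distrib[of x y z] strong_distrib[of x "inv x" z]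
  by (simp add: defect_def)

text \<open>
  The right-hand side is \<open>x (x\<inverse> a + x\<inverse> b)\<close>. Inserting the identity between the two inner summands
  changes nothing; after multiplication it appears as \<open>x\<close>, at the price of a second defect.
\<close>

lemma defect_regular:
  assumes [simp]: "a \<in> carrier B" "b \<in> carrier B" "x \<in> carrier B"
  shows "a \<boxplus> (defect x \<boxplus> (x \<boxplus> (defect x \<boxplus> b))) = a \<boxplus> (defect x \<boxplus> b)"
proof -
  note [simp] = add_closed
  have "x \<otimes> (inv x \<otimes> a \<boxplus> (\<one> \<boxplus> inv x \<otimes> b)) = x \<otimes> (inv x \<otimes> a \<boxplus> inv x \<otimes> b)"
    by (simp add: one_absorbed)
  then show ?thesis by (simp add: distrib_defect flip: m_assoc)
qed

text \<open>
  Multiplying \<open>a + b\<close> by \<open>x\<inverse>\<close> and then by \<open>x\<close> leaves it unchanged, so the defects that accumulate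
  between \<open>a\<close> and \<open>b\<close> cancel. Hence \<open>defect x\<close> has inverses on both sides between summands.
\<close>

lemma defect_unit:
  assumes [simp]: "a \<in> carrier B" "b \<in> carrier B" "x \<in> carrier B"
  shows "a \<boxplus> (defect x \<boxplus> (x \<otimes> defect (inv x) \<boxplus> (defect x \<boxplus> b))) = a \<boxplus> b"
proof -
  note [simp] = add_closed
  have "x \<otimes> (inv x \<otimes> (a \<boxplus> b)) = a \<boxplus> b" by (simp flip: m_assoc)
  then show ?thesis by (simp add: distrib_defect flip: m_assoc)
qed

text \<open>
  In the monoid that the elements form between summands, \<open>defect x\<close> is invertible and
  \<open>defect x + x + defect x = defect x\<close>, so that its inverse is \<open>x\<close>.
\<close>

lemma
  assumes [simp]: "a \<in> carrier B" "b \<in> carrier B" "x \<in> carrier B"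
  shows defect_left_inverse: "a \<boxplus> (defect x \<boxplus> (x \<boxplus> b)) = a \<boxplus> b"
    and defect_right_inverse: "a \<boxplus> (x \<boxplus> (defect x \<boxplus> b)) = a \<boxplus> b"
proof -
  note [simp] = add_closed
  let ?h = "x \<otimes> defect (inv x)"
  have "a \<boxplus> (defect x \<boxplus> (x \<boxplus> b))
    = a \<boxplus> (defect x \<boxplus> (x \<boxplus> (defect x \<boxplus> (?h \<boxplus> (defect x \<boxplus> b)))))"
    by (simp add: defect_unit)
  also have "\<dots> = a \<boxplus> (defect x \<boxplus> (?h \<boxplus> (defect x \<boxplus> b)))"
    by (rule defect_regular) simp_all
  also have "\<dots> = a \<boxplus> b"
    by (rule defect_unit) simp_all
  finally show "a \<boxplus> (defect x \<boxplus> (x \<boxplus> b)) = a \<boxplus> b" .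
  have "a \<boxplus> (x \<boxplus> (defect x \<boxplus> b))
    = a \<boxplus> (defect x \<boxplus> (?h \<boxplus> (defect x \<boxplus> (x \<boxplus> (defect x \<boxplus> b)))))"
    by (simp add: defect_unit)
  also have "\<dots> = a \<boxplus> b"
    by (simp add: defect_regular defect_unit)
  finally show "a \<boxplus> (x \<boxplus> (defect x \<boxplus> b)) = a \<boxplus> b" .
qed

text \<open>
  Left multiplication maps sums to sums and is transitive, so one sum suffices to reach every
  element.
\<close>

lemma every_element_is_sum:
  assumes [simp]: "w \<in> carrier B"
  shows "\<exists>a\<in>carrier B. \<exists>b\<in>carrier B. w = a \<boxplus> b"
proof -
  note [simp] = add_closed
  let ?x = "w \<otimes> inv (\<one> \<boxplus> \<one>)"
  have "w = ?x \<otimes> (\<one> \<boxplus> \<one>)" by (simp add: m_assoc)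
  also have "\<dots> = ?x \<boxplus> (defect ?x \<boxplus> ?x)" by (simp add: distrib_defect)
  finally show ?thesis
    by (intro bexI[of _ ?x] bexI[of _ "defect ?x \<boxplus> ?x"]) simp_all
qed

lemma rectangular_group_add: "rectangular_group (carrier B) add"
  by (rule rectangular_group_of_inner_inverses[of \<one> defect])
    (simp_all add: one_absorbed defect_left_inverse defect_right_inverse every_element_is_sum)

lemma one_add_idempotent: "\<one> \<boxplus> \<one> = \<one>"
  by (rule neutral_idempotent_of_inner_inverses[of \<one> defect])
    (simp_all add: one_absorbed defect_left_inverse defect_right_inverse every_element_is_sum)

lemma yang_baxter:
  assumes r: "\<And>x y. \<lbrakk>x \<in> carrier B; y \<in> carrier B\<rbrakk>
      \<Longrightarrow> r (x, y) = (x \<otimes> (inv x \<boxplus> y), inv (inv x \<boxplus> y) \<otimes> y)"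
  shows "yang_baxter_solution (carrier B) r"
proof (rule yang_baxter_of_matched_actions[where lam = "\<lambda>x y. x \<otimes> (inv x \<boxplus> y)"
      and rho = "rho_bar B add"])
  note [simp] = add_closed
  fix x y assume [simp]: "x \<in> carrier B" "y \<in> carrier B"
  show "r (x, y) = (x \<otimes> (inv x \<boxplus> y), rho_bar B add y x)"
    by (simp add: r rho_bar_def)
  show "x \<otimes> (inv x \<boxplus> y) \<in> carrier B" by simp
  show "rho_bar B add y x \<in> carrier B" by (simp add: rho_bar_def)
  have "(inv x \<boxplus> y) \<otimes> (inv (inv x \<boxplus> y) \<otimes> y) = y"
    by (simp flip: m_assoc)
  then show "x \<otimes> (inv x \<boxplus> y) \<otimes> rho_bar B add y x = x \<otimes> y"
    by (simp add: rho_bar_def m_assoc)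
  fix z assume [simp]: "z \<in> carrier B"
  show "rho_bar B add (y \<otimes> z) x = rho_bar B add z (rho_bar B add y x)"
    by (simp add: rho_bar_anti_hom compose_def)
  \<comment> \<open>The semibrace law for \<open>y\<close> with left summand \<open>(x y)\<inverse>\<close>, which \<open>y\<close> turns into \<open>x\<inverse>\<close>.\<close>
  have "y \<otimes> (inv (x \<otimes> y) \<boxplus> z) = inv x \<boxplus> y \<otimes> (inv y \<boxplus> z)"
    using semibrace_distrib[of y "inv (x \<otimes> y)" z]
    by (simp add: inv_mult_group flip: m_assoc)
  then show "x \<otimes> y \<otimes> (inv (x \<otimes> y) \<boxplus> z) = x \<otimes> (inv x \<boxplus> y \<otimes> (inv y \<boxplus> z))"
    by (simp add: m_assoc)
qed

end

section \<open>The group of a near left semibrace based at \<open>\<mu>(e)\<close>\<close>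

context near_left_semibrace
begin

lemma mu_mem [simp]: "x \<in> carrier B \<Longrightarrow> mu x \<in> carrier B"
  using mu_closed by blast

lemma mu_one_absorbed:
  assumes "y \<in> carrier B" "z \<in> carrier B"
  shows "y \<boxplus> (mu \<one> \<boxplus> z) = y \<boxplus> z"
  using near_distrib[of \<one> y z] assms by (simp add: add_assoc add_closed)

lemma circ_simps [simp]:
  "carrier (circ_group B mu) = carrier B"
  "x \<otimes>\<^bsub>circ_group B mu\<^esub> y = x \<otimes> inv (mu \<one>) \<otimes> y"
  "\<one>\<^bsub>circ_group B mu\<^esub> = mu \<one>"
  by (simp_all add: circ_group_def)

lemma circ_bar_closed [simp]: "x \<in> carrier B \<Longrightarrow> circ_bar B mu x \<in> carrier B"
  by (simp add: circ_bar_def)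

lemma circ_bar_cancel:
  assumes [simp]: "x \<in> carrier B"
  shows "circ_bar B mu x \<otimes> inv (mu \<one>) \<otimes> x = mu \<one>"
    and "x \<otimes> inv (mu \<one>) \<otimes> circ_bar B mu x = mu \<one>"
proof -
  have "mu \<one> \<otimes> (inv (mu \<one>) \<otimes> x) = x" "x \<otimes> (inv x \<otimes> mu \<one>) = mu \<one>"
    "inv (mu \<one>) \<otimes> (mu \<one> \<otimes> (inv x \<otimes> mu \<one>)) = inv x \<otimes> mu \<one>"
    by (simp_all flip: m_assoc)
  then show "circ_bar B mu x \<otimes> inv (mu \<one>) \<otimes> x = mu \<one>"
    and "x \<otimes> inv (mu \<one>) \<otimes> circ_bar B mu x = mu \<one>"
    by (simp_all add: circ_bar_def m_assoc)
qed

lemma group_circ: "group (circ_group B mu)"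
proof (rule groupI)
  fix x assume x: "x \<in> carrier (circ_group B mu)"
  show "\<exists>y\<in>carrier (circ_group B mu). y \<otimes>\<^bsub>circ_group B mu\<^esub> x = \<one>\<^bsub>circ_group B mu\<^esub>"
    by (rule bexI[of _ "circ_bar B mu x"]) (use x circ_bar_cancel in auto)
qed (simp_all add: m_assoc)

lemma inv_circ:
  assumes "x \<in> carrier B"
  shows "inv\<^bsub>circ_group B mu\<^esub> x = circ_bar B mu x"
  using assms circ_bar_cancel by (intro group.inv_equality[OF group_circ]) simp_all

lemma circ_distrib:
  assumes "x \<in> carrier B" "y \<in> carrier B" "z \<in> carrier B"
  shows "x \<otimes>\<^bsub>circ_group B mu\<^esub> (y \<boxplus> z)
    = x \<otimes>\<^bsub>circ_group B mu\<^esub> y \<boxplus> (mu (x \<otimes> inv (mu \<one>)) \<boxplus> x \<otimes>\<^bsub>circ_group B mu\<^esub> z)"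
  using assms by (simp add: near_distrib add_assoc)

text \<open>
  Expanding \<open>x \<circ> (y + z)\<close> and the right-hand side of either law by the distributive law for \<open>\<circ>\<close>
  leaves expressions that differ only by a summand \<open>\<mu>(e)\<close> between two others.
\<close>

lemma strong_left_semibrace_circ: "strong_left_semibrace (circ_group B mu) add"
proof -
  interpret C: group "circ_group B mu" by (rule group_circ)
  note closed = add_closed C.m_closed[simplified circ_simps(1)] C.inv_closed[simplified circ_simps(1)]
  note [simp del] = circ_simps(2)
  note [simp] = closed
  have semi: "left_semibrace (circ_group B mu) add"
  proof
    fix x y z
    show "x \<boxplus> y \<in> carrier (circ_group B mu)"
      if "x \<in> carrier (circ_group B mu)" "y \<in> carrier (circ_group B mu)"
      using that by simp
    show "x \<boxplus> y \<boxplus> z = x \<boxplus> (y \<boxplus> z)"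
      if "x \<in> carrier (circ_group B mu)" "y \<in> carrier (circ_group B mu)"
        "z \<in> carrier (circ_group B mu)"
      using that by (simp add: add_assoc)
    assume "x \<in> carrier (circ_group B mu)" "y \<in> carrier (circ_group B mu)"
      "z \<in> carrier (circ_group B mu)"
    then have [simp]: "x \<in> carrier B" "y \<in> carrier B" "z \<in> carrier B" by simp_all
    show "x \<otimes>\<^bsub>circ_group B mu\<^esub> (y \<boxplus> z) = x \<otimes>\<^bsub>circ_group B mu\<^esub> y
      \<boxplus> x \<otimes>\<^bsub>circ_group B mu\<^esub> (inv\<^bsub>circ_group B mu\<^esub> x \<boxplus> z)"
      using C.r_inv[of x] by (simp add: circ_distrib mu_one_absorbed)
  qed
  interpret left_semibrace "circ_group B mu" add
    rewrites "carrier (circ_group B mu) = carrier B" by (rule semi) simp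
  show ?thesis
  proof
    fix a b assume "a \<in> carrier (circ_group B mu)" "b \<in> carrier (circ_group B mu)"
    then have [simp]: "a \<in> carrier B" "b \<in> carrier B" by simp_all
    let ?C = "circ_group B mu"
    show "rho_bar ?C add (a \<otimes>\<^bsub>?C\<^esub> b)
      = compose (carrier ?C) (rho_bar ?C add b) (rho_bar ?C add a)"
    proof
      fix c
      show "rho_bar ?C add (a \<otimes>\<^bsub>?C\<^esub> b) c
        = compose (carrier ?C) (rho_bar ?C add b) (rho_bar ?C add a) c"
      proof (cases "c \<in> carrier B")
        case c[simp]: True
        let ?d = "inv\<^bsub>?C\<^esub> c" and ?a = "inv\<^bsub>?C\<^esub> a"
        have split: "?a \<otimes>\<^bsub>?C\<^esub> (?d \<boxplus> a \<otimes>\<^bsub>?C\<^esub> b) = ?a \<otimes>\<^bsub>?C\<^esub> (?d \<boxplus> a) \<boxplus> b"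
        proof -
          have "?a \<otimes>\<^bsub>?C\<^esub> (a \<otimes>\<^bsub>?C\<^esub> b) = b"
            using C.m_assoc[of ?a a b] C.l_inv[of a] C.l_one[of b] by simp
          then show ?thesis
            using C.l_inv[of a] by (simp add: circ_distrib add_assoc mu_one_absorbed)
        qed
        have "inv\<^bsub>?C\<^esub> (?d \<boxplus> a \<otimes>\<^bsub>?C\<^esub> b) \<otimes>\<^bsub>?C\<^esub> (a \<otimes>\<^bsub>?C\<^esub> b)
          = inv\<^bsub>?C\<^esub> (?a \<otimes>\<^bsub>?C\<^esub> (?d \<boxplus> a \<otimes>\<^bsub>?C\<^esub> b)) \<otimes>\<^bsub>?C\<^esub> b"
          by (simp add: C.inv_mult_group C.m_assoc)
        moreover have "inv\<^bsub>?C\<^esub> (inv\<^bsub>?C\<^esub> (?d \<boxplus> a) \<otimes>\<^bsub>?C\<^esub> a) = ?a \<otimes>\<^bsub>?C\<^esub> (?d \<boxplus> a)"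
          by (simp add: C.inv_mult_group)
        ultimately show ?thesis
          by (simp add: rho_bar_def compose_def split)
      qed (simp add: rho_bar_def compose_def)
    qed
  qed
qed

end

theorem theorem4p4:
  fixes B :: "('a, 'b) monoid_scheme" and add :: "'a \<Rightarrow> 'a \<Rightarrow> 'a" and mu :: "'a \<Rightarrow> 'a"
  assumes "near_left_semibrace B add mu"
  shows "strong_left_semibrace (circ_group B mu) add \<and>
    rectangular_group (carrier B) add \<and>
    mu \<one>\<^bsub>B\<^esub> \<in> add_idempotents (carrier B) add \<and>
    yang_baxter_solution (carrier B) (r_bar B add mu)"
proof -
  interpret near_left_semibrace B add mu by (fact assms)
  have strong: "strong_left_semibrace (circ_group B mu) add"
    by (rule strong_left_semibrace_circ)
  have "yang_baxter_solution (carrier (circ_group B mu)) (r_bar B add mu)"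
    by (rule strong_left_semibrace.yang_baxter[OF strong])
      (simp add: r_bar_def inv_circ add_closed)
  then show ?thesis
    using strong strong_left_semibrace.rectangular_group_add[OF strong]
      strong_left_semibrace.one_add_idempotent[OF strong]
    by (simp add: add_idempotents_def)
qed

end
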